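(* Consider the $T\overline T$ flow of the BMS free scalar with seed Lagrangian $\mathcal L^{(0)}=(\partial_y\phi)^2$, i.e. the sequence $\mathcal L^{(n)}$, $n\ge 0$, of functions of $(\partial_x\phi,\partial_y\phi)$ determined by $\mathcal L^{(0)}$ and the $T\overline T$ recursion relation given in the context. Then for all $n\ge 0$ $$\mathcal L^{(n)}=\frac{(-4)^n}{1+n}\,\frac{\Gamma(\tfrac12+n)}{\Gamma(\tfrac12)}\,(\partial_y\phi)^{2n+2},$$ and the deformed Lagrangian is, as a formal power series in $\lambda$, $$\mathcal L^{[\lambda]}=\sum_{n=0}^\infty\frac{\lambda^n}{n!}\mathcal L^{(n)}=\frac{\sqrt{4\lambda(\partial_y\phi)^2+1}-1}{2\lambda}.$$
   Context: $\phi=\phi(x,y)$ is a real scalar field; $\partial_x\phi,\partial_y\phi$ are treated as independent commuting variables (classical Lagrangian). Indices $\mu,\nu\in\{x,y\}$, repeated indices are summed, and $C_n^i=\binom{n}{i}$. The $T\overline T$ deformation is the flow $\partial_\lambda\mathcal L^{[\lambda]}=\det T^{\mu[\lambda]}_{\ \nu}$ with $\mathcal L^{[0]}=\mathcal L^{(0)}$, where $T^{\mu[\lambda]}_{\ \nu}=\frac{\partial\mathcal L^{[\lambda]}}{\partial(\partial_\mu\phi)}\partial_\nu\phi-\delta^\mu_{\ \nu}\mathcal L^{[\lambda]}$. Expanding $\mathcal L^{[\lambda]}=\sum_{n\ge0}\frac{\lambda^n}{n!}\mathcal L^{(n)}$ and $T^{\mu[\lambda]}_{\ \nu}=\sum_{n\ge0}\frac{\lambda^n}{n!}T^{\mu(n)}_{\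 \nu}$, it is equivalent to the recursion, for $n\ge0$, $$\mathcal L^{(n+1)}=\frac12\sum_{i=0}^n C_n^i\left(T^{\mu(i)}_{\ \mu}T^{\nu(n-i)}_{\ \nu}-T^{\mu(i)}_{\ \nu}T^{\nu(n-i)}_{\ \mu}\right),\qquad T^{\mu(n)}_{\ \nu}=\frac{\partial\mathcal L^{(n)}}{\partial(\partial_\mu\phi)}\partial_\nu\phi-\delta^\mu_{\ \nu}\mathcal L^{(n)}.$$ *)

theory Defs
  imports "HOL-Analysis.Analysis" "HOL-Computational_Algebra.Formal_Power_Series"
begin

datatype coord = X | Y

text \<open>
  A point \<open>d\<close> collects the values of the partial derivatives of the field,
  \<open>d \<mu> = \<partial>\<^sub>\<mu>\<phi>\<close>, regarded as independent real variables; a Lagrangian is a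
  function of them.
\<close>

type_synonym gradient = "coord \<Rightarrow> real"
type_synonym lagrangian = "gradient \<Rightarrow> real"

text \<open>\<open>\<partial>L/\<partial>(\<partial>\<^sub>\<mu>\<phi>)\<close>, with the other component of the gradient held fixed:\<close>

definition partial :: "coord \<Rightarrow> lagrangian \<Rightarrow> lagrangian" where
  "partial \<mu> L d = deriv (\<lambda>t. L (d(\<mu> := t))) (d \<mu>)"

text \<open>\<open>stress L \<mu> \<nu>\<close> is \<open>T\<^sup>\<mu>\<^sub>\<nu>\<close>: the first index is the upper one.\<close>

definition stress :: "lagrangian \<Rightarrow> coord \<Rightarrow> coord \<Rightarrow> lagrangian" where
  "stress L \<mu> \<nu> d = partial \<mu> L d * d \<nu> - (if \<mu> = \<nu> then L d else 0)"

fun TTbar :: "lagrangian \<Rightarrow> nat \<Rightarrow> lagrangian" where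
  "TTbar L0 0 = L0"
| "TTbar L0 (Suc n) = (\<lambda>d. 1 / 2 * (\<Sum>i\<le>n. real (n choose i) *
     ((\<Sum>\<mu>\<in>{X, Y}. \<Sum>\<nu>\<in>{X, Y}.
         stress (TTbar L0 i) \<mu> \<mu> d * stress (TTbar L0 (n - i)) \<nu> \<nu> d
       - stress (TTbar L0 i) \<mu> \<nu> d * stress (TTbar L0 (n - i)) \<nu> \<mu> d))))"

text \<open>The deformed Lagrangian as a formal power series in \<open>\<lambda>\<close>, at each value of the gradient:\<close>

definition deformed_lagrangian :: "lagrangian \<Rightarrow> gradient \<Rightarrow> real fps" where
  "deformed_lagrangian L0 d = Abs_fps (\<lambda>n. TTbar L0 n d / fact n)"

definition bms_seed :: lagrangian where
  "bms_seed d = (d Y)\<^sup>2"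

end

theory Submission
  imports Defs
begin

text \<open>
  If \<open>\<L>\<^sup>(\<^sup>i\<^sup>)\<close> is \<open>i! b\<^sub>i\<close> times the power \<open>2i + 2\<close> of the \<open>y\<close>-derivative for all \<open>i \<le> n\<close>,
  the stress tensors are triangular, and the recursion reduces to
  \<open>b\<^sub>n\<^sub>+\<^sub>1 = - \<Sum>i\<le>n. b\<^sub>i b\<^sub>n\<^sub>-\<^sub>i\<close>. The solution is the Catalan sequence with
  alternating signs. Writing it through the binomial coefficients of \<open>1/2\<close>, both the
  convolution identity and the generating function are Vandermonde's identity
  for \<open>1/2 + 1/2 = 1\<close>.
\<close>

definition signed_catalan :: "nat \<Rightarrow> real" where
  "signed_catalan n = 4 ^ Suc n / 2 * ((1 / 2) gchoose Suc n)"

lemma signed_catalan_0: "signed_catalan 0 = 1"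
  by (simp add: signed_catalan_def)

text \<open>Splitting off the first factor \<open>- (1 / 2)\<close> of the rising factorial behind
  \<open>(1 / 2) gchoose Suc n\<close> leaves \<open>pochhammer (1 / 2) n\<close>, which is the
  Gamma quotient because 1/2 is not a pole.\<close>

lemma fact_signed_catalan_Gamma:
  "fact n * signed_catalan n = (- 4) ^ n / (1 + real n) * (Gamma (1 / 2 + real n) / Gamma (1 / 2))"
proof -
  have half: "(1 / 2 :: real) \<notin> \<int>\<^sub>\<le>\<^sub>0"
    by (auto elim!: nonpos_Ints_cases')
  have "(1 / 2 :: real) gchoose Suc n
      = (-1) ^ Suc n * (- (1 / 2) * pochhammer (1 / 2) n) / fact (Suc n)"
    by (simp add: gbinomial_pochhammer pochhammer_rec)
  moreover have "(- 4 :: real) ^ n = (-1) ^ n * 4 ^ n"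
    by (simp flip: power_mult_distrib)
  ultimately have "fact n * signed_catalan n = (- 4) ^ n / (1 + real n) * pochhammer (1 / 2) n"
    by (simp add: signed_catalan_def divide_simps) (simp add: algebra_simps)
  then show ?thesis
    by (simp add: pochhammer_Gamma[OF half])
qed

lemma gbinomial_half_convolution:
  "(\<Sum>k\<le>m. ((1 / 2 :: real) gchoose k) * ((1 / 2) gchoose (m - k))) = 1 gchoose m"
  using gbinomial_Vandermonde[of "1 / 2 :: real" "1 / 2" m] by (simp add: atLeast0AtMost)

text \<open>The square of (1 + z)^(1/2) has no term of degree n + 2. In that convolution the two end
  terms give \<open>signed_catalan (Suc n)\<close> and the inner ones the sum, up to a common power
  of 4.\<close>

lemma signed_catalan_Suc:
  "signed_catalan (Suc n) = - (\<Sum>i\<le>n. signed_catalan i * signed_catalan (n - i))"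
proof -
  let ?g = "\<lambda>k. (1 / 2 :: real) gchoose k"
  have "0 = (1 :: real) gchoose Suc (Suc n)"
    using binomial_gbinomial[of 1 "Suc (Suc n)", where 'a = real] by simp
  also have "\<dots> = (\<Sum>k\<le>Suc (Suc n). ?g k * ?g (Suc (Suc n) - k))"
    by (simp only: gbinomial_half_convolution)
  also have "\<dots> = 2 * ?g (Suc (Suc n)) + (\<Sum>i\<le>n. ?g (Suc i) * ?g (Suc n - i))"
    by (subst sum.atMost_Suc_shift, subst sum.atMost_Suc) simp
  also have "(\<Sum>i\<le>n. ?g (Suc i) * ?g (Suc n - i)) = (\<Sum>i\<le>n. ?g (Suc i) * ?g (Suc (n - i)))"
    by (intro sum.cong) (auto simp: Suc_diff_le)
  finally have *: "(\<Sum>i\<le>n. ?g (Suc i) * ?g (Suc (n - i))) = - 2 * ?g (Suc (Suc n))"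
    by simp
  have "(\<Sum>i\<le>n. signed_catalan i * signed_catalan (n - i))
      = (\<Sum>i\<le>n. 4 ^ Suc n * (?g (Suc i) * ?g (Suc (n - i))))"
  proof (intro sum.cong refl)
    fix i assume "i \<in> {..n}"
    then have "(4 :: real) ^ n = 4 ^ i * 4 ^ (n - i)"
      by (simp flip: power_add)
    then show "signed_catalan i * signed_catalan (n - i)
        = 4 ^ Suc n * (?g (Suc i) * ?g (Suc (n - i)))"
      by (simp add: signed_catalan_def)
  qed
  also have "\<dots> = - signed_catalan (Suc n)"
    unfolding sum_distrib_left[symmetric] * by (simp add: signed_catalan_def)
  finally show ?thesis by simp
qed

lemma stress_monomial:
  fixes c :: real and k :: nat
  defines "L \<equiv> \<lambda>d :: gradient. c * d Y ^ k"
  shows "stress L X X d = - (c * d Y ^ k)"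
    and "stress L X Y d = 0"
    and "stress L Y Y d = (real k - 1) * (c * d Y ^ k)"
proof -
  have x: "partial X L d = 0"
    by (simp add: partial_def L_def)
  have y: "partial Y L d = c * (real k * d Y ^ (k - 1))"
    unfolding partial_def L_def
    by (rule DERIV_imp_deriv) (auto intro!: derivative_eq_intros)
  show "stress L X X d = - (c * d Y ^ k)" "stress L X Y d = 0"
    by (simp_all add: stress_def x) (simp add: L_def)
  show "stress L Y Y d = (real k - 1) * (c * d Y ^ k)"
    \<comment> \<open>The exponent \<open>k - 1\<close> truncates at \<open>k = 0\<close>, where the
      factor \<open>real k\<close> kills the derivative.\<close>
    by (cases k) (simp_all add: stress_def y, simp_all add: L_def algebra_simps)
qed

lemma TTbar_bms_seed:
  "TTbar bms_seed n = (\<lambda>d. fact n * signed_catalan n * d Y ^ (2 * n + 2))"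
proof (induction n rule: less_induct)
  case (less n)
  show ?case
  proof (cases n)
    case 0
    then show ?thesis
      by (auto simp: bms_seed_def signed_catalan_0 power2_eq_square)
  next
    case (Suc m)
    let ?L = "\<lambda>i (d :: gradient). fact i * signed_catalan i * d Y ^ (2 * i + 2)"
    show ?thesis
    proof
      fix d :: gradient
      have "TTbar bms_seed n d = 1 / 2 * (\<Sum>i\<le>m. real (m choose i) *
          ((\<Sum>\<mu>\<in>{X, Y}. \<Sum>\<nu>\<in>{X, Y}. stress (?L i) \<mu> \<mu> d * stress (?L (m - i)) \<nu> \<nu> d
              - stress (?L i) \<mu> \<nu> d * stress (?L (m - i)) \<nu> \<mu> d)))"
        unfolding Suc TTbar.simps
        using less Suc by (intro arg_cong2[where f = "(*)"] refl sum.cong) auto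
      also have "\<dots> = 1 / 2 * (\<Sum>i\<le>m. - 2 * fact (Suc m) * d Y ^ (2 * n + 2)
          * (signed_catalan i * signed_catalan (m - i)))"
      proof (rule arg_cong2[where f = "(*)", OF refl sum.cong[OF refl]])
        fix i assume "i \<in> {..m}"
        then have i: "i \<le> m" by simp
        have pow: "d Y ^ (2 * n + 2) = d Y ^ (2 * i + 2) * d Y ^ (2 * (m - i) + 2)"
          unfolding power_add[symmetric]
          by (rule arg_cong[where f = "(^) (d Y)"]) (use i Suc in simp)
        \<comment> \<open>The binomial weight absorbs the factorials of both factors, so only a
          common factor free of \<open>i\<close> remains.\<close>
        have binom: "fact (Suc m)
            = (real m + 1) * (real (m choose i) * fact i * (fact (m - i) :: real))"
          using binomial_fact[OF i, where 'a = real] by simp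
        have m: "real (m - i) = real m - real i"
          using i by (simp add: of_nat_diff)
        let ?S = "\<Sum>\<mu>\<in>{X, Y}. \<Sum>\<nu>\<in>{X, Y}. stress (?L i) \<mu> \<mu> d * stress (?L (m - i)) \<nu> \<nu> d
              - stress (?L i) \<mu> \<nu> d * stress (?L (m - i)) \<nu> \<mu> d"
        \<comment> \<open>Terms with \<mu> = \<nu> cancel. Each mixed product contains an upper-X,
          lower-Y entry, which vanishes, so the entries \<open>Y X\<close> may be nonzero.\<close>
        have "?S = stress (?L i) X X d * stress (?L (m - i)) Y Y d
              + stress (?L i) Y Y d * stress (?L (m - i)) X X d"
          by (simp add: stress_monomial(2) del: power_Suc)
        \<comment> \<open>The diagonal coefficients 2i + 1 and 2(m - i) + 1 add up to 2m + 2,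
          independently of \<open>i\<close>; hence the recursion becomes a plain
          convolution.\<close>
        also have "\<dots> = - (2 * real m + 2) * (?L i d * ?L (m - i) d)"
          unfolding stress_monomial by (simp only: of_nat_add of_nat_mult of_nat_numeral m) algebra
        finally have S: "?S = - (2 * real m + 2) * (?L i d * ?L (m - i) d)" .
        show "real (m choose i) * ?S
            = - 2 * fact (Suc m) * d Y ^ (2 * n + 2) * (signed_catalan i * signed_catalan (m - i))"
          unfolding S pow binom by algebra
      qed
      also have "\<dots> = fact n * signed_catalan n * d Y ^ (2 * n + 2)"
        unfolding sum_distrib_left[symmetric] Suc signed_catalan_Suc by simp
      finally show "TTbar bms_seed n d = fact n * signed_catalan n * d Y ^ (2 * n + 2)" .
    qed
  qed
qed

text \<open>The convolution recurrence says that the series D satisfies D = u - X D^2 with u the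
  seed value. Multiplying by 4X and completing the square gives the claim.\<close>

lemma one_plus_deformed_bms_square:
  "(2 * fps_X * deformed_lagrangian bms_seed d + 1)\<^sup>2 = 4 * fps_X * fps_const ((d Y)\<^sup>2) + 1"
proof -
  let ?D = "deformed_lagrangian bms_seed d"
  have nth: "fps_nth ?D n = signed_catalan n * d Y ^ (2 * n + 2)" for n
    by (simp add: deformed_lagrangian_def TTbar_bms_seed)
  have "?D = fps_const ((d Y)\<^sup>2) - fps_X * ?D\<^sup>2"
  proof (rule fps_ext)
    fix n
    show "fps_nth ?D n = fps_nth (fps_const ((d Y)\<^sup>2) - fps_X * ?D\<^sup>2) n"
    proof (cases n)
      case 0
      then show ?thesis
        by (simp add: nth signed_catalan_0 power2_eq_square)
    next
      case (Suc m)
      have "fps_nth (?D\<^sup>2) m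
          = (\<Sum>i\<le>m. (signed_catalan i * signed_catalan (m - i)) * d Y ^ (2 * n + 2))"
        unfolding power2_eq_square fps_mult_nth nth atLeast0AtMost
      proof (intro sum.cong refl)
        fix i assume "i \<in> {..m}"
        then have "d Y ^ (2 * n + 2) = d Y ^ (2 * i + 2) * d Y ^ (2 * (m - i) + 2)"
          unfolding power_add[symmetric]
          by (intro arg_cong[where f = "(^) (d Y)"]) (use Suc in simp)
        then show "signed_catalan i * d Y ^ (2 * i + 2)
              * (signed_catalan (m - i) * d Y ^ (2 * (m - i) + 2))
            = signed_catalan i * signed_catalan (m - i) * d Y ^ (2 * n + 2)"
          by (simp only: mult_ac)
      qed
      then show ?thesis
        by (simp add: Suc nth signed_catalan_Suc sum_distrib_right)
    qed
  qed
  then show ?thesis by algebra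
qed

theorem mainTheorem2:
  shows "(\<forall>n d. TTbar bms_seed n d =
            (- 4) ^ n / (1 + real n) * (Gamma (1 / 2 + real n) / Gamma (1 / 2)) * d Y ^ (2 * n + 2))
       \<and> (\<forall>d. deformed_lagrangian bms_seed d =
            (fps_radical root 2 (4 * fps_X * fps_const ((d Y)\<^sup>2) + 1) - 1) / (2 * fps_X))"
proof (intro conjI allI)
  fix n d
  show "TTbar bms_seed n d =
      (- 4) ^ n / (1 + real n) * (Gamma (1 / 2 + real n) / Gamma (1 / 2)) * d Y ^ (2 * n + 2)"
    by (simp only: TTbar_bms_seed fact_signed_catalan_Gamma)
next
  fix d
  let ?D = "deformed_lagrangian bms_seed d"
  let ?S = "4 * fps_X * fps_const ((d Y)\<^sup>2) + 1 :: real fps"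
  \<comment> \<open>Both sides have constant term 1, which selects the branch of the square
    root.\<close>
  have "2 * fps_X * ?D + 1 = fps_radical root (Suc 1) ?S"
  proof (rule radical_unique[THEN iffD1])
    show "(2 * fps_X * ?D + 1) ^ Suc 1 = ?S"
      using one_plus_deformed_bms_square[of d] by (simp add: numeral_2_eq_2)
  qed (simp_all add: mult.assoc)
  then have "2 * fps_X * ?D = fps_radical root 2 ?S - 1"
    by (simp add: numeral_2_eq_2 algebra_simps)
  \<comment> \<open>The divisor is not a unit, but the numerator is a multiple of it, so the
    quotient is exact.\<close>
  moreover have "2 * fps_X * ?D / (2 * fps_X) = ?D"
    by (rule nonzero_mult_div_cancel_left) simp
  ultimately show "?D = (fps_radical root 2 ?S - 1) / (2 * fps_X)"
    by simp
qed

end
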